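(* Let $n\ge 1$, let $\sigma\in\{(ba),(a-cb),(b-ca),(c-ba),(a-ba),(b-ba)\}$, and let $m=(m_1,\dots,m_n)$ be a vector of positive integers. For $w\in A^*_{m}$ put $F_\sigma(m,q)=\sum_{w\in A^*_m}q^{\sigma(w)}$. Then $$F_\sigma(m,q)=\sum_{\emptyset\neq T\subseteq[n]}\ \Bigl(\prod_{j=1}^{|T|-1}\bigl(q^{e_\sigma(m,T,j)}-1\bigr)\Bigr)\,F_\sigma(m-\mathbf 1_T,q),$$ where, writing $T=\{t_1>t_2>\cdots>t_{|T|}\}$, the exponents are \begin{itemize} \item $e_{(ba)}(m,T,j)=1$; \item $e_{(a-cb)}(m,T,j)=m_1+m_2+\cdots+m_{t_{j+1}-1}-|T|+j+1$; \item $e_{(b-ca)}(m,T,j)=m_{t_{j+1}+1}+m_{t_{j+1}+2}+\cdots+m_{t_j-1}$; \item $e_{(c-ba)}(m,T,j)=m_{t_j+1}+m_{t_j+2}+\cdots+m_n$; \item $e_{(a-ba)}(m,T,j)=m_{t_{j+1}}-1$; \item $e_{(b-ba)}(m,T,j)=m_{t_j}-1$. \end{itemize} Moreover, if $m\in\mathbb N^n$ has some $m_i=0$, then $F_\sigma(m,q)=F_\sigma(\hat m,q)$ with $\hat m=(m_1,\dots,m_{i-1},m_{i+1},\dots,m_n)$, and $F_\sigma(m,q)=1$ if all $m_i=0$. The same recurrence and initial conditions hold with $\sigma$ replaced by its reversal $\sigma^r$, where $\sigma^r(w)=\sigma(w^r)$ (with the same exponents $e_\sigma$).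
   Context: $[n]=\{1,\dots,n\}$, $\mathbb N=\{0,1,2,\dots\}$. For $m\in\mathbb N^n$, $A^*_m$ is the set of all words in the alphabet $[n]$ containing exactly $m_i$ copies of the letter $i$ for each $i$ (permutations of the multiset). $\mathbf 1_T\in\{0,1\}^n$ is the indicator vector of $T$. Empty products equal $1$ and empty sums equal $0$. $w^r=w_\ell\cdots w_1$ is the reversal of $w=w_1\cdots w_\ell$. Pattern functions count occurrences in a word $w=w_1\cdots w_\ell$: $(ba)(w)=|\{i: w_i>w_{i+1}\}|$. A pattern of the form $(x-yz)$ counts the pairs $(i,j)$ with $1\le i<j<\ell$ such that the letters $w_i,w_j,w_{j+1}$ are order-isomorphic to $x,y,z$ (where $a<b<c$, and equal pattern letters correspond to equal word letters, distinct ones to distinct word letters). E.g. $(a-cb)$ counts pairs with $w_i<w_{j+1}<w_j$; $(b-ca)$: $w_{j+1}<w_i<w_j$; $(c-ba)$: $w_{j+1}<w_j<w_i$; $(a-ba)$: $w_i=w_{j+1}<w_j$; $(b-ba)$: $w_{j+1}<w_j=w_i$. *)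

theory Defs
  imports Main
begin

(* A vector m in N^n is a function nat => nat of which only the values at 1..n matter. *)

definition words :: "nat \<Rightarrow> (nat \<Rightarrow> nat) \<Rightarrow> nat list set" where
  "words n m = {w. set w \<subseteq> {1..n} \<and> (\<forall>i\<in>{1..n}. count_list w i = m i)}"

definition order_isomorphic :: "nat list \<Rightarrow> nat list \<Rightarrow> bool" where
  "order_isomorphic u v \<longleftrightarrow> length u = length v \<and>
     (\<forall>i<length u. \<forall>j<length u.
        (u ! i < u ! j \<longleftrightarrow> v ! i < v ! j) \<and> (u ! i = u ! j \<longleftrightarrow> v ! i = v ! j))"

definition count_ba :: "nat list \<Rightarrow> nat" where
  "count_ba w = card {i. i + 1 < length w \<and> w ! i > w ! (i + 1)}"

text \<open>The pattern (x-yz); the letters a, b, c are represented by 1, 2, 3.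
  Positions in lists are numbered from 0.\<close>

definition count_vinc :: "nat \<Rightarrow> nat \<Rightarrow> nat \<Rightarrow> nat list \<Rightarrow> nat" where
  "count_vinc x y z w =
     card {(i, j). i < j \<and> j + 1 < length w \<and>
                   order_isomorphic [w ! i, w ! j, w ! (j + 1)] [x, y, z]}"

datatype pattern = BA | A_CB | B_CA | C_BA | A_BA | B_BA

fun pattern_count :: "pattern \<Rightarrow> nat list \<Rightarrow> nat" where
  "pattern_count BA = count_ba"
| "pattern_count A_CB = count_vinc 1 3 2"
| "pattern_count B_CA = count_vinc 2 3 1"
| "pattern_count C_BA = count_vinc 3 2 1"
| "pattern_count A_BA = count_vinc 1 2 1"
| "pattern_count B_BA = count_vinc 2 2 1"

definition reversed :: "(nat list \<Rightarrow> nat) \<Rightarrow> nat list \<Rightarrow> nat" where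
  "reversed s w = s (rev w)"

definition gen_fun :: "(nat list \<Rightarrow> nat) \<Rightarrow> nat \<Rightarrow> (nat \<Rightarrow> nat) \<Rightarrow> 'a::comm_ring_1 \<Rightarrow> 'a" where
  "gen_fun s n m q = (\<Sum>w\<in>words n m. q ^ s w)"

text \<open>For \<open>T = {t\<^sub>1 > t\<^sub>2 > \<dots>}\<close>, \<open>elt T j\<close> is \<open>t\<^sub>j\<close>.\<close>

definition elt :: "nat set \<Rightarrow> nat \<Rightarrow> nat" where
  "elt T j = rev (sorted_list_of_set T) ! (j - 1)"

text \<open>If all \<open>m i\<close> with \<open>1 \<le> i \<le> n\<close> are positive, \<open>T \<subseteq> {1..n}\<close> and \<open>1 \<le> j < card T\<close>, none of
  the subtractions below truncates: in the case of \<open>A_CB\<close>, \<open>T\<close> has \<open>card T - j - 1\<close> elements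
  below \<open>elt T (j + 1)\<close>.\<close>

fun exponent :: "pattern \<Rightarrow> nat \<Rightarrow> (nat \<Rightarrow> nat) \<Rightarrow> nat set \<Rightarrow> nat \<Rightarrow> nat" where
  "exponent BA n m T j = 1"
| "exponent A_CB n m T j = (\<Sum>k\<in>{1..<elt T (j + 1)}. m k) + j + 1 - card T"
| "exponent B_CA n m T j = (\<Sum>k\<in>{elt T (j + 1)<..<elt T j}. m k)"
| "exponent C_BA n m T j = (\<Sum>k\<in>{elt T j<..n}. m k)"
| "exponent A_BA n m T j = m (elt T (j + 1)) - 1"
| "exponent B_BA n m T j = m (elt T j) - 1"

definition minus_indicator :: "(nat \<Rightarrow> nat) \<Rightarrow> nat set \<Rightarrow> nat \<Rightarrow> nat" where
  "minus_indicator m T k = (if k \<in> T then m k - 1 else m k)"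

definition delete_entry :: "nat \<Rightarrow> (nat \<Rightarrow> nat) \<Rightarrow> nat \<Rightarrow> nat" where
  "delete_entry i m k = (if k < i then m k else m (k + 1))"

end

theory Submission
  imports Defs
begin

text \<open>Every pattern count is a sum over the descents \<open>w\<^sub>j > w\<^sub>j\<^sub>+\<^sub>1\<close> of a weight that depends only on
  \<open>w\<^sub>j\<close>, \<open>w\<^sub>j\<^sub>+\<^sub>1\<close> and the multiset of letters before them. A pair of a set \<open>T\<close> and a word \<open>u\<close> on the
  right-hand side of the recurrence is the same as a word \<open>w\<close> (\<open>u\<close> followed by \<open>T\<close> in decreasing
  order) with a chosen nonempty strictly decreasing suffix, and the exponents are the weights of the
  descents in this suffix. For a fixed \<open>w\<close> the sum over its decreasing suffixes telescopes to
  its own contribution. Words are read from right to left, so that suffixes become prefixes and the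
  telescoping is an induction on lists.\<close>

section \<open>Words\<close>

text \<open>The count of letters with a given property depends on \<open>m\<close> alone. This
  bounds the length of the words, which gives finiteness, and later turns the filter lengths in the
  descent weights into the sums of \<open>m k\<close> in the exponents.\<close>

lemma length_filter_words:
  assumes "w \<in> words n m"
  shows "length (filter P w) = (\<Sum>c | c \<in> {1..n} \<and> P c. m c)"
proof -
  have "set (filter P w) \<subseteq> {c. c \<in> {1..n} \<and> P c}"
    using assms by (auto simp: words_def)
  then have "length (filter P w) = (\<Sum>c | c \<in> {1..n} \<and> P c. count_list (filter P w) c)"
    by (intro sum_count_set[symmetric]) auto
  also have "\<dots> = (\<Sum>c | c \<in> {1..n} \<and> P c. m c)"
  proof (intro sum.cong refl)
    fix c assume c: "c \<in> {c. c \<in> {1..n} \<and> P c}"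
    then have "count_list (filter P w) c = count_list w c"
      by (induction w) auto
    then show "count_list (filter P w) c = m c"
      using c assms by (simp add: words_def)
  qed
  finally show ?thesis .
qed

lemma finite_words: "finite (words n m)"
proof (rule finite_subset)
  show "words n m \<subseteq> {w. set w \<subseteq> {1..n} \<and> length w = (\<Sum>c | c \<in> {1..n} \<and> True. m c)}"
    using length_filter_words[where P = "\<lambda>_. True"] by (auto simp: words_def)
qed (simp add: finite_lists_length_eq)

lemma rev_in_words_iff: "rev w \<in> words n m \<longleftrightarrow> w \<in> words n m"
  by (simp add: words_def)

text \<open>Reversal permutes the words of content \<open>m\<close>. Hence a recurrence for either
  of \<sigma> and its reversal is one for both.\<close>

lemma gen_fun_reversed: "gen_fun (reversed s) n m q = gen_fun s n m q"
  unfolding gen_fun_def reversed_def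
  by (rule sum.reindex_bij_witness[where i = rev and j = rev]) (auto simp: rev_in_words_iff)

lemma words_zero:
  assumes "\<forall>i\<in>{1..n}. m i = 0"
  shows "words n m = {[]}"
proof -
  have "w = []" if "w \<in> words n m" for w
    using length_filter_words[OF that, of "\<lambda>_. True"] assms by simp
  then show ?thesis
    using assms by (auto simp: words_def)
qed

lemma count_list_distinct: "distinct w \<Longrightarrow> count_list w c = (if c \<in> set w then 1 else 0)"
  by (induction w) auto

text \<open>The sorted list uses each letter of \<open>T\<close> exactly once. Positivity of
  \<open>m\<close> keeps the subtraction in \<open>minus_indicator\<close> from truncating, so that
  the equivalence holds in both directions.\<close>

lemma append_sorted_in_words_iff:
  assumes "T \<subseteq> {1..n}" "\<forall>i\<in>{1..n}. m i > 0"
  shows "sorted_list_of_set T @ u \<in> words n m \<longleftrightarrow> u \<in> words n (minus_indicator m T)"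
proof -
  have "finite T"
    using assms(1) finite_subset by blast
  moreover have "(if c \<in> T then 1 else 0) + count_list u c = m c \<longleftrightarrow>
      count_list u c = minus_indicator m T c" if "c \<in> {1..n}" for c
    using assms(2) that by (auto simp: minus_indicator_def)
  ultimately show ?thesis
    using assms(1) by (simp add: words_def count_list_distinct)
qed

section \<open>Deleting an unused letter\<close>

text \<open>The order embedding of the naturals whose image omits exactly \<open>i\<close>. Being
  strictly increasing, it preserves all pattern counts.\<close>

definition skip_letter :: "nat \<Rightarrow> nat \<Rightarrow> nat" where
  "skip_letter i c = (if c < i then c else c + 1)"

lemma strict_mono_skip_letter: "strict_mono (skip_letter i)"
  by (auto simp: strict_mono_def skip_letter_def)

lemma words_delete_entry:
  assumes i: "i \<in> {1..n}" and "m i = 0"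
  shows "words n m = map (skip_letter i) ` words (n - 1) (delete_entry i m)"
proof (intro equalityI subsetI)
  have inj: "inj (skip_letter i)"
    using strict_mono_skip_letter by (rule strict_mono_imp_inj_on)
  fix w assume w: "w \<in> words n m"
  \<comment> \<open>\<open>g\<close> inverts \<open>skip_letter i\<close> on letters other than
    \<open>i\<close>; its value at \<open>i\<close> is irrelevant because \<open>i\<close> does not
    occur in \<open>w\<close>.\<close>
  define g where "g c = (if c < i then c else c - 1)" for c :: nat
  have "count_list w i = 0"
    using w assms by (auto simp: words_def)
  then have "i \<notin> set w"
    by (simp add: count_list_0_iff)
  then have "skip_letter i (g c) = c" if "c \<in> set w" for c
    using that by (cases "c = i") (auto simp: skip_letter_def g_def)
  then have wg: "map (skip_letter i) (map g w) = w"
    by (simp add: map_idI)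
  have "map g w \<in> words (n - 1) (delete_entry i m)"
    unfolding words_def
  proof (intro CollectI conjI ballI)
    have "g c \<in> {1..n - 1}" if "c \<in> set w" for c
    proof -
      have "c \<in> {1..n}" "c \<noteq> i"
        using that w \<open>i \<notin> set w\<close> by (auto simp: words_def)
      then show ?thesis
        using i by (auto simp: g_def)
    qed
    then show "set (map g w) \<subseteq> {1..n - 1}"
      by auto
    fix c assume c: "c \<in> {1..n - 1}"
    have "count_list (map g w) c = count_list w (skip_letter i c)"
      using count_list_map_conv[OF inj, of "map g w" c] wg by simp
    also have "\<dots> = delete_entry i m c"
      using w c i by (auto simp: words_def skip_letter_def delete_entry_def)
    finally show "count_list (map g w) c = delete_entry i m c" .
  qed
  then show "w \<in> map (skip_letter i) ` words (n - 1) (delete_entry i m)"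
    using wg by (metis image_eqI)
next
  have inj: "inj (skip_letter i)"
    using strict_mono_skip_letter by (rule strict_mono_imp_inj_on)
  fix w assume "w \<in> map (skip_letter i) ` words (n - 1) (delete_entry i m)"
  then obtain v where v: "v \<in> words (n - 1) (delete_entry i m)" "w = map (skip_letter i) v"
    by blast
  have "count_list w c = m c" if c: "c \<in> {1..n}" for c
  proof (cases "c = i")
    case True
    then have "c \<notin> set w"
      using v by (auto simp: skip_letter_def split: if_splits)
    then show ?thesis
      using True assms by (simp add: count_list_0_iff)
  next
    case False
    define d where "d = (if c < i then c else c - 1)"
    have d: "skip_letter i d = c" "d \<in> {1..n - 1}"
      using False c i by (auto simp: skip_letter_def d_def)
    then have "count_list w c = count_list v d"
      using count_list_map_conv[OF inj, of v d] v by simp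
    then show ?thesis
      using v d by (auto simp: words_def delete_entry_def skip_letter_def split: if_splits)
  qed
  moreover have "set w \<subseteq> {1..n}"
    using v i by (fastforce simp: words_def skip_letter_def)
  ultimately show "w \<in> words n m"
    by (simp add: words_def)
qed

lemma order_isomorphic_map:
  assumes "strict_mono h"
  shows "order_isomorphic (map h u) p \<longleftrightarrow> order_isomorphic u p"
  using assms by (auto simp: order_isomorphic_def strict_mono_less strict_mono_eq)

lemma count_vinc_map:
  assumes "strict_mono h"
  shows "count_vinc x y z (map h w) = count_vinc x y z w"
proof -
  have "order_isomorphic [map h w ! i, map h w ! j, map h w ! (j + 1)] [x, y, z] \<longleftrightarrow>
      order_isomorphic [w ! i, w ! j, w ! (j + 1)] [x, y, z]"
    if "i < j" "j + 1 < length w" for i j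
    using order_isomorphic_map[OF assms, of "[w ! i, w ! j, w ! (j + 1)]"] that by simp
  then show ?thesis
    unfolding count_vinc_def by (metis (no_types, lifting) length_map)
qed

lemma count_ba_map:
  assumes "strict_mono h"
  shows "count_ba (map h w) = count_ba w"
  unfolding count_ba_def
  by (rule arg_cong[where f = card]) (auto simp: strict_mono_less[OF assms])

lemma pattern_count_map: "strict_mono h \<Longrightarrow> pattern_count \<sigma> (map h w) = pattern_count \<sigma> w"
  by (cases \<sigma>) (simp_all add: count_ba_map count_vinc_map)

lemma gen_fun_delete_entry:
  assumes "i \<in> {1..n}" "m i = 0"
  shows "gen_fun (pattern_count \<sigma>) n m q =
    gen_fun (pattern_count \<sigma>) (n - 1) (delete_entry i m) q"
proof -
  have "inj (skip_letter i)"
    using strict_mono_skip_letter by (rule strict_mono_imp_inj_on)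
  then have "inj_on (map (skip_letter i)) A" for A
    by (simp add: inj_on_mapI inj_on_subset)
  then show ?thesis
    unfolding gen_fun_def words_delete_entry[where m = m, OF assms]
    by (simp add: sum.reindex pattern_count_map strict_mono_skip_letter)
qed

section \<open>Descent weights\<close>

text \<open>The number of pattern occurrences whose adjacent pair is the given \<open>b\<close>,
  \<open>a\<close>, where \<open>v\<close> lists the letters before this pair in the original word.
  Each clause forces \<open>a < b\<close>, so only descents have weight.\<close>

fun descent_weight :: "pattern \<Rightarrow> nat \<Rightarrow> nat \<Rightarrow> nat list \<Rightarrow> nat" where
  "descent_weight BA b a v = (if a < b then 1 else 0)"
| "descent_weight A_CB b a v = length (filter (\<lambda>c. c < a \<and> a < b) v)"
| "descent_weight B_CA b a v = length (filter (\<lambda>c. a < c \<and> c < b) v)"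
| "descent_weight C_BA b a v = length (filter (\<lambda>c. a < b \<and> b < c) v)"
| "descent_weight A_BA b a v = length (filter (\<lambda>c. c = a \<and> a < b) v)"
| "descent_weight B_BA b a v = length (filter (\<lambda>c. c = b \<and> a < b) v)"

lemma descent_weight_0: "b \<le> a \<Longrightarrow> descent_weight \<sigma> b a v = 0"
  by (cases \<sigma>) auto

lemma count_vinc_short: "length w \<le> 1 \<Longrightarrow> count_vinc x y z w = 0"
  by (simp add: count_vinc_def)

text \<open>Appending \<open>a\<close> creates a single new adjacent pair, the one at
  \<open>j = length w\<close>. All earlier occurrences persist, and the new ones are indexed by the
  positions in \<open>w\<close> of their first letter.\<close>

lemma count_vinc_snoc:
  "count_vinc x y z (w @ [b, a]) =
    count_vinc x y z (w @ [b]) + length (filter (\<lambda>c. order_isomorphic [c, b, a] [x, y, z]) w)"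
proof -
  let ?occ = "\<lambda>w i j. order_isomorphic [w ! i, w ! j, w ! (j + 1)] [x, y, z]"
  let ?old = "{(i, j). i < j \<and> j + 1 < length (w @ [b]) \<and> ?occ (w @ [b]) i j}"
  let ?new = "{i. i < length w \<and> order_isomorphic [w ! i, b, a] [x, y, z]}"
  let ?new' = "(\<lambda>i. (i, length w)) ` ?new"
  have "{(i, j). i < j \<and> j + 1 < length (w @ [b, a]) \<and> ?occ (w @ [b, a]) i j} = ?old \<union> ?new'"
    by (auto simp: nth_append less_Suc_eq)
  moreover have "finite ?old"
    by (rule finite_subset[of _ "{..length w} \<times> {..length w}"]) auto
  moreover have "?old \<inter> ?new' = {}"
    by auto
  moreover have "card ?new' = card ?new"
    by (intro card_image) (auto simp: inj_on_def)
  ultimately show ?thesis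
    by (simp add: count_vinc_def card_Un_disjoint length_filter_conv_card)
qed

lemma count_ba_short: "length w \<le> 1 \<Longrightarrow> count_ba w = 0"
  by (simp add: count_ba_def)

lemma count_ba_snoc: "count_ba (w @ [b, a]) = count_ba (w @ [b]) + (if a < b then 1 else 0)"
proof -
  let ?old = "{i. i + 1 < length (w @ [b]) \<and> (w @ [b]) ! i > (w @ [b]) ! (i + 1)}"
  let ?new = "if a < b then {length w} else {}"
  have "{i. i + 1 < length (w @ [b, a]) \<and> (w @ [b, a]) ! i > (w @ [b, a]) ! (i + 1)} = ?old \<union> ?new"
    by (auto simp: nth_append less_Suc_eq)
  moreover have "?old \<inter> ?new = {}"
    by auto
  moreover have "finite ?old" "finite ?new"
    by auto
  ultimately show ?thesis
    by (simp add: count_ba_def card_Un_disjoint)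
qed

lemma order_isomorphic_3:
  "order_isomorphic [c, b, a] [x, y, z] \<longleftrightarrow>
    (c < b \<longleftrightarrow> x < y) \<and> (c = b \<longleftrightarrow> x = y) \<and> (c < a \<longleftrightarrow> x < z) \<and> (c = a \<longleftrightarrow> x = z) \<and>
    (b < a \<longleftrightarrow> y < z) \<and> (b = a \<longleftrightarrow> y = z)"
  by (auto simp: order_isomorphic_def less_Suc_eq numeral_3_eq_3)

text \<open>The heads \<open>a\<close>, \<open>b\<close> are the last two letters of the reversed
  list, so the snoc lemmas apply with \<open>rev v\<close> in front. A filter length does not depend
  on the order of the letters, which replaces \<open>rev v\<close> by \<open>v\<close>.\<close>

lemma reversed_pattern_count_Cons:
  "reversed (pattern_count \<sigma>) (a # b # v) =
    reversed (pattern_count \<sigma>) (b # v) + descent_weight \<sigma> b a v"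
proof -
  have rev_filter: "length (filter P (rev v)) = length (filter Q v)"
    if "\<And>c. P c \<longleftrightarrow> Q c" for P Q
    using that by (simp flip: rev_filter cong: filter_cong)
  show ?thesis
    by (cases \<sigma>)
      (auto simp: reversed_def count_ba_snoc count_vinc_snoc order_isomorphic_3
        intro!: rev_filter)
qed

lemma reversed_pattern_count_short: "length v \<le> 1 \<Longrightarrow> reversed (pattern_count \<sigma>) v = 0"
  by (cases \<sigma>) (simp_all add: reversed_def count_ba_short count_vinc_short)

section \<open>Telescoping over increasing prefixes\<close>

text \<open>A prefix is encoded by its length; the bound by \<open>length v\<close> makes this
  one-to-one, since \<open>take\<close> is constant beyond it. The bound \<open>1 \<le> k\<close>
  matches the condition that \<open>T\<close> is nonempty.\<close>

definition inc_prefix_lengths :: "nat list \<Rightarrow> nat set" where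
  "inc_prefix_lengths v = {k. 1 \<le> k \<and> k \<le> length v \<and> sorted_wrt (<) (take k v)}"

lemma finite_inc_prefix_lengths: "finite (inc_prefix_lengths v)"
  by (rule finite_subset[of _ "{..length v}"]) (auto simp: inc_prefix_lengths_def)

lemma inc_prefix_lengths_singleton: "inc_prefix_lengths [a] = {1}"
  by (auto simp: inc_prefix_lengths_def le_Suc_eq)

text \<open>By transitivity, a prefix with at least two letters increases iff \<open>a < b\<close>
  and its part from \<open>b\<close> on increases.\<close>

lemma inc_prefix_lengths_Cons:
  "inc_prefix_lengths (a # b # v) =
    insert 1 (if a < b then Suc ` inc_prefix_lengths (b # v) else {})" (is "?L = ?R")
proof -
  have "k \<in> ?L \<longleftrightarrow> k \<in> ?R" for k
  proof (cases k)
    case 0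
    then show ?thesis
      by (auto simp: inc_prefix_lengths_def)
  next
    case (Suc l)
    show ?thesis
    proof (cases l)
      case 0
      then show ?thesis
        using Suc by (simp add: inc_prefix_lengths_def)
    next
      case (Suc l')
      then show ?thesis
        using \<open>k = Suc l\<close> by (force simp: inc_prefix_lengths_def)
    qed
  qed
  then show ?thesis
    by blast
qed

text \<open>The prefix of length 1 contributes \<open>q ^ r (b # v)\<close>. If
  \<open>a < b\<close>, the longer prefixes contribute \<open>q ^ wt b a v - 1\<close> times the
  same power, by the induction hypothesis, and the two add up to
  \<open>q ^ (r (b # v) + wt b a v)\<close>. Otherwise there are no longer prefixes and the weight
  is 0.\<close>

lemma sum_inc_prefixes:
  fixes q :: "'a::comm_ring_1"
  assumes short: "\<And>a. r [a] = r []"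
    and step: "\<And>a b v. r (a # b # v) = r (b # v) + wt b a v"
    and no_descent: "\<And>a b v. b \<le> a \<Longrightarrow> wt b a v = 0"
    and "v \<noteq> []"
  shows "(\<Sum>k\<in>inc_prefix_lengths v.
      (\<Prod>i<k - 1. q ^ wt (v ! Suc i) (v ! i) (drop (i + 2) v) - 1) * q ^ r (drop k v)) = q ^ r v"
  using \<open>v \<noteq> []\<close>
proof (induction v rule: induct_list012)
  case 1
  then show ?case by simp
next
  case (2 a)
  then show ?case
    by (simp add: inc_prefix_lengths_singleton short)
next
  case (3 a b v)
  let ?f = "\<lambda>v k. (\<Prod>i<k - 1. q ^ wt (v ! Suc i) (v ! i) (drop (i + 2) v) - 1) * q ^ r (drop k v)"
  show ?case
  proof (cases "a < b")
    case False
    then show ?thesis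
      by (simp add: inc_prefix_lengths_Cons step no_descent)
  next
    case True
    have shift: "?f (a # b # v) (Suc k) = (q ^ wt b a v - 1) * ?f (b # v) k"
      if k: "k \<in> inc_prefix_lengths (b # v)" for k
    proof -
      \<comment> \<open>Since \<open>k\<close> is positive, the product on the left has a factor at
        index 0, namely \<open>q ^ wt b a v - 1\<close>. Splitting it off shifts the other indices
        to those of \<open>b # v\<close>.\<close>
      obtain l where "k = Suc l"
        using k by (cases k) (simp_all add: inc_prefix_lengths_def)
      then show ?thesis
        by (simp only: diff_Suc_1 prod.lessThan_Suc_shift) (simp add: mult.assoc)
    qed
    have "1 \<notin> Suc ` inc_prefix_lengths (b # v)"
      by (auto simp: inc_prefix_lengths_def)
    then have "(\<Sum>k\<in>inc_prefix_lengths (a # b # v). ?f (a # b # v) k) =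
        ?f (a # b # v) 1 + (\<Sum>k\<in>Suc ` inc_prefix_lengths (b # v). ?f (a # b # v) k)"
      using True by (simp add: inc_prefix_lengths_Cons finite_inc_prefix_lengths)
    also have "(\<Sum>k\<in>Suc ` inc_prefix_lengths (b # v). ?f (a # b # v) k) =
        (\<Sum>k\<in>inc_prefix_lengths (b # v). (q ^ wt b a v - 1) * ?f (b # v) k)"
      by (subst sum.reindex, simp, simp only: o_def, intro sum.cong refl shift)
    also have "\<dots> = (q ^ wt b a v - 1) * q ^ r (b # v)"
      using "3.IH"(2) by (simp only: flip: sum_distrib_left) simp
    also have "?f (a # b # v) 1 = q ^ r (b # v)"
      by simp
    also have "q ^ r (b # v) + (q ^ wt b a v - 1) * q ^ r (b # v) = q ^ r (a # b # v)"
      by (simp add: step power_add algebra_simps)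
    finally show ?thesis .
  qed
qed

section \<open>The exponents as descent weights\<close>

text \<open>\<open>elt\<close> numbers \<open>T\<close> from 1 downwards from its maximum, while the
  prefix lists it upwards from index 0. So for \<open>j = card T - Suc i\<close> the letters
  \<open>v ! Suc i\<close> and \<open>v ! i\<close> are \<open>elt T j\<close> and
  \<open>elt T (j + 1)\<close>. The weight counts letters after these two: it is a total given by
  \<open>m\<close>, less what the first \<open>i + 2\<close> letters contribute.\<close>

lemma exponent_eq_descent_weight:
  assumes T: "T \<subseteq> {1..n}" and w: "sorted_list_of_set T @ u \<in> words n m"
    and i: "Suc i < card T"
  defines "v \<equiv> sorted_list_of_set T @ u"
  shows "exponent \<sigma> n m T (card T - Suc i) =
    descent_weight \<sigma> (v ! Suc i) (v ! i) (drop (i + 2) v)"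
proof -
  let ?S = "sorted_list_of_set T"
  have fin: "finite T"
    using T finite_subset by blast
  define a b where "a = v ! i" and "b = v ! Suc i"
  have aS: "a = ?S ! i" and bS: "b = ?S ! Suc i"
    using i by (auto simp: a_def b_def v_def nth_append)
  have elt_b: "elt T (card T - Suc i) = b"
    using i by (simp add: elt_def rev_nth bS)
  have elt_a: "elt T (card T - Suc i + 1) = a"
    using i by (simp add: elt_def rev_nth aS)
  have sorted: "sorted_wrt (<) ?S"
    by simp
  have ab: "a < b"
    using sorted_wrt_nth_less[OF sorted, of i "Suc i"] i by (simp add: aS bS)
  have mem: "a \<in> {1..n}" "b \<in> {1..n}"
    using T fin i nth_mem[of i ?S] nth_mem[of "Suc i" ?S] by (auto simp: aS bS)
  have low: "\<forall>c\<in>set (take i v). c < a"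
  proof
    fix c assume "c \<in> set (take i v)"
    then obtain l where "l < i" "c = ?S ! l"
      using i by (auto simp: in_set_conv_nth v_def nth_append)
    then show "c < a"
      using sorted_wrt_nth_less[OF sorted, of l i] i by (simp add: aS)
  qed
  have lenv: "Suc i < length v"
    using i by (simp add: v_def)
  have split: "v = take i v @ a # b # drop (i + 2) v"
    using lenv by (simp add: a_def b_def Cons_nth_drop_Suc)
  \<comment> \<open>An additive form of this count, which avoids subtraction of naturals.\<close>
  have total: "length (filter P (take i v)) + (if P a then 1 else 0) + (if P b then 1 else 0) +
      length (filter P (drop (i + 2) v)) = (\<Sum>c | c \<in> {1..n} \<and> P c. m c)" for P
  proof -
    have "length (filter P v) = (\<Sum>c | c \<in> {1..n} \<and> P c. m c)"
      using length_filter_words[OF w] by (simp only: v_def)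
    then show ?thesis
      by (subst (asm) split) (simp split: if_splits)
  qed
  have take_none: "filter P (take i v) = []" if "\<And>c. c < a \<Longrightarrow> \<not> P c" for P
    using low that by (auto simp: filter_empty_conv)
  have "exponent \<sigma> n m T (card T - Suc i) = descent_weight \<sigma> b a (drop (i + 2) v)"
  proof (cases \<sigma>)
    case BA
    then show ?thesis using ab by simp
  next
    \<comment> \<open>Here the \<open>i\<close> letters before \<open>a\<close> all count, being
      smaller than \<open>a\<close>. This is the correction in the exponent: with
      \<open>j = card T - Suc i\<close>, the term \<open>j + 1 - card T\<close> equals
      \<open>- i\<close> over the integers.\<close>
    case A_CB
    have "filter (\<lambda>c. c < a) (take i v) = take i v"
      using low by simp
    moreover have "{c. c \<in> {1..n} \<and> c < a} = {1..<a}"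
      using mem by auto
    ultimately show ?thesis
      using A_CB total[of "\<lambda>c. c < a"] ab elt_a i lenv by simp
  next
    case B_CA
    have "{c. c \<in> {1..n} \<and> a < c \<and> c < b} = {a<..<b}"
      using mem by auto
    then show ?thesis
      using B_CA total[of "\<lambda>c. a < c \<and> c < b"] elt_a elt_b take_none[of "\<lambda>c. a < c \<and> c < b"]
      by simp
  next
    case C_BA
    have "{c. c \<in> {1..n} \<and> b < c} = {b<..n}"
      using mem by auto
    then show ?thesis
      using C_BA total[of "\<lambda>c. b < c"] ab elt_b take_none[of "\<lambda>c. b < c"] by simp
  next
    \<comment> \<open>The one copy of \<open>a\<close> in the prefix accounts for the
      \<open>- 1\<close> in the exponent; likewise for \<open>b\<close> in the next case.\<close>
    case A_BA
    have "{c. c \<in> {1..n} \<and> c = a} = {a}"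
      using mem by auto
    then show ?thesis
      using A_BA total[of "\<lambda>c. c = a"] ab elt_a take_none[of "\<lambda>c. c = a"] by simp
  next
    case B_BA
    have "{c. c \<in> {1..n} \<and> c = b} = {b}"
      using mem by auto
    then show ?thesis
      using B_BA total[of "\<lambda>c. c = b"] ab elt_b take_none[of "\<lambda>c. c = b"] by simp
  qed
  then show ?thesis
    by (simp add: a_def b_def)
qed

section \<open>The recurrence\<close>

lemma gen_fun_recurrence:
  fixes q :: "'a::comm_ring_1"
  assumes n: "n \<ge> 1" and pos: "\<forall>i\<in>{1..n}. m i > 0"
  shows "gen_fun (reversed (pattern_count \<sigma>)) n m q =
    (\<Sum>T\<in>{T. T \<noteq> {} \<and> T \<subseteq> {1..n}}.
      (\<Prod>j\<in>{1..card T - 1}. q ^ exponent \<sigma> n m T j - 1) *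
      gen_fun (reversed (pattern_count \<sigma>)) n (minus_indicator m T) q)"
proof -
  define r where "r = reversed (pattern_count \<sigma>)"
  define wt where "wt = descent_weight \<sigma>"
  define f where
    "f v k = (\<Prod>i<k - 1. q ^ wt (v ! Suc i) (v ! i) (drop (i + 2) v) - 1) * q ^ r (drop k v)" for v k
  define g where
    "g T u = (\<Prod>j\<in>{1..card T - 1}. q ^ exponent \<sigma> n m T j - 1) * q ^ r u" for T u
  let ?Ts = "{T. T \<noteq> {} \<and> T \<subseteq> {1..n}}"
  have fin_T: "finite T" if "T \<subseteq> {1..n}" for T
    using that finite_subset by blast
  have telescope: "(\<Sum>k\<in>inc_prefix_lengths v. f v k) = q ^ r v" if "v \<in> words n m" for v
  proof -
    \<comment> \<open>The telescoping requires a nonempty word, as the empty word has no nonempty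
      prefix. The letter 1 occurs because \<open>n \<ge> 1\<close> and \<open>m 1\<close> is
      positive.\<close>
    have "count_list v 1 > 0"
      using that n pos by (simp add: words_def)
    then have "v \<noteq> []"
      by auto
    then show ?thesis
      unfolding f_def
      by (intro sum_inc_prefixes)
        (simp_all add: r_def wt_def reversed_pattern_count_short reversed_pattern_count_Cons
          descent_weight_0)
  qed
  have f_eq_g: "f (sorted_list_of_set T @ u) (card T) = g T u"
    if T: "T \<subseteq> {1..n}" and u: "u \<in> words n (minus_indicator m T)" for T u
  proof -
    let ?v = "sorted_list_of_set T @ u"
    have v: "?v \<in> words n m"
      using append_sorted_in_words_iff[OF T pos] u by blast
    have "(\<Prod>i<card T - 1. q ^ wt (?v ! Suc i) (?v ! i) (drop (i + 2) ?v) - 1) =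
        (\<Prod>j\<in>{1..card T - 1}. q ^ exponent \<sigma> n m T j - 1)"
    \<comment> \<open>The reindexing reverses the order: the left product runs up through
      \<open>T\<close>, the right one down.\<close>
    proof (rule prod.reindex_bij_witness
        [where i = "\<lambda>j. card T - Suc j" and j = "\<lambda>i. card T - Suc i"])
      fix i assume "i \<in> {..<card T - 1}"
      then have "Suc i < card T"
        by auto
      then show "q ^ exponent \<sigma> n m T (card T - Suc i) - 1 =
          q ^ wt (?v ! Suc i) (?v ! i) (drop (i + 2) ?v) - 1"
        by (simp only: wt_def exponent_eq_descent_weight[OF T v])
    qed auto
    then show ?thesis
      by (simp add: f_def g_def)
  qed
  have prefix: "sorted_list_of_set (set (take k v)) = take k v" "card (set (take k v)) = k"
      "set (take k v) \<noteq> {}" "set (take k v) \<subseteq> {1..n}"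
      "drop k v \<in> words n (minus_indicator m (set (take k v)))"
    if v: "v \<in> words n m" and k: "k \<in> inc_prefix_lengths v" for v k
  proof -
    have k': "1 \<le> k" "k \<le> length v" and sorted: "sorted_wrt (<) (take k v)"
      using k by (auto simp: inc_prefix_lengths_def)
    show eq: "sorted_list_of_set (set (take k v)) = take k v"
      using sorted by (simp add: strict_sorted_iff sorted_list_of_set.idem_if_sorted_distinct)
    show "card (set (take k v)) = k"
      using sorted k' by (simp add: strict_sorted_iff distinct_card)
    show "set (take k v) \<noteq> {}"
      using k' by auto
    show sub: "set (take k v) \<subseteq> {1..n}"
      using v set_take_subset[of k v] by (auto simp: words_def)
    show "drop k v \<in> words n (minus_indicator m (set (take k v)))"
      using append_sorted_in_words_iff[OF sub pos, of "drop k v"] v by (simp add: eq)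
  qed
  have "gen_fun r n m q = (\<Sum>v\<in>words n m. \<Sum>k\<in>inc_prefix_lengths v. f v k)"
    by (simp add: gen_fun_def telescope)
  also have "\<dots> = (\<Sum>(v, k)\<in>Sigma (words n m) inc_prefix_lengths. f v k)"
    by (simp add: sum.Sigma finite_words finite_inc_prefix_lengths)
  \<comment> \<open>A word with a marked increasing prefix corresponds to the set \<open>T\<close>
    of the letters of this prefix and the remaining word \<open>u\<close>. Sorting \<open>T\<close>
    recovers the prefix, and its length is \<open>card T\<close>.\<close>
  also have "\<dots> = (\<Sum>(T, u)\<in>Sigma ?Ts (\<lambda>T. words n (minus_indicator m T)). g T u)"
  proof (rule sum.reindex_bij_witness
      [where i = "\<lambda>(T, u). (sorted_list_of_set T @ u, card T)"
        and j = "\<lambda>(v, k). (set (take k v), drop k v)"], goal_cases)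
    case (1 x)
    then show ?case
      by (auto simp: prefix)
  next
    case (2 x)
    then show ?case
      using prefix by fastforce
  next
    case (3 y)
    then show ?case
      by (auto simp: fin_T)
  next
    case (4 y)
    then obtain T u where y: "y = (T, u)" "T \<noteq> {}" "T \<subseteq> {1..n}"
        "u \<in> words n (minus_indicator m T)"
      by auto
    have "1 \<le> card T"
      using y fin_T by (simp add: Suc_le_eq card_gt_0_iff)
    then show ?case
      using y append_sorted_in_words_iff[OF y(3) pos] by (simp add: inc_prefix_lengths_def)
  next
    case (5 x)
    then obtain v k where x: "x = (v, k)" "v \<in> words n m" "k \<in> inc_prefix_lengths v"
      by auto
    from f_eq_g[OF prefix(4,5)[OF x(2,3)]] show ?case
      by (simp add: x prefix)
  qed
  also have "\<dots> = (\<Sum>T\<in>?Ts. \<Sum>u\<in>words n (minus_indicator m T). g T u)"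
    by (subst sum.Sigma) (auto simp: finite_words)
  also have "\<dots> = (\<Sum>T\<in>?Ts. (\<Prod>j\<in>{1..card T - 1}. q ^ exponent \<sigma> n m T j - 1) *
      gen_fun r n (minus_indicator m T) q)"
    by (simp add: g_def gen_fun_def sum_distrib_left)
  finally show ?thesis
    by (simp add: r_def)
qed

theorem mainTheorem1:
  fixes n :: nat and \<sigma> :: pattern and s :: "nat list \<Rightarrow> nat" and q :: "'a::comm_ring_1"
  assumes "n \<ge> 1"
    and "s = pattern_count \<sigma> \<or> s = reversed (pattern_count \<sigma>)"
  shows "(\<forall>m. (\<forall>i\<in>{1..n}. m i > 0) \<longrightarrow>
            gen_fun s n m q =
              (\<Sum>T\<in>{T. T \<noteq> {} \<and> T \<subseteq> {1..n}}.
                 (\<Prod>j\<in>{1..card T - 1}. q ^ exponent \<sigma> n m T j - 1) *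
                 gen_fun s n (minus_indicator m T) q)) \<and>
         (\<forall>m. \<forall>i\<in>{1..n}. m i = 0 \<longrightarrow>
            gen_fun s n m q = gen_fun s (n - 1) (delete_entry i m) q) \<and>
         (\<forall>m. (\<forall>i\<in>{1..n}. m i = 0) \<longrightarrow> gen_fun s n m q = 1)"
proof -
  \<comment> \<open>Both choices of \<open>s\<close> have the same generating function, so all three
    claims need proof for one of them only.\<close>
  have s: "gen_fun s n m q = gen_fun (pattern_count \<sigma>) n m q" for n m and q :: 'a
    using assms(2) by (elim disjE) (simp_all add: gen_fun_reversed)
  have "pattern_count \<sigma> [] = 0"
    using reversed_pattern_count_short[of "[]" \<sigma>] by (simp add: reversed_def)
  then have "gen_fun s n m q = 1" if "\<forall>i\<in>{1..n}. m i = 0" for m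
    using words_zero[OF that] unfolding s by (simp add: gen_fun_def)
  then show ?thesis
    using gen_fun_recurrence[OF assms(1), of _ \<sigma> q] gen_fun_delete_entry[of _ n _ \<sigma> q]
    unfolding s gen_fun_reversed by blast
qed

end
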